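(* For every real number $a>0$, $$\pi\, m\big((1+x)+a(1-x)y\big) = -i\,\mathcal{L}^a_2(i),$$ where the polynomial is in the two variables $x,y$.
   Context: The (logarithmic) Mahler measure of a nonzero polynomial $P\in\mathbb{C}[x_1,\dots,x_n]$ is $m(P)=\frac{1}{(2\pi i)^n}\int_{\mathbb{T}^n}\log|P(x_1,\dots,x_n)|\,\frac{dx_1}{x_1}\cdots\frac{dx_n}{x_n}$, with $\mathbb{T}^n=\{|x_1|=\dots=|x_n|=1\}$. $\mathrm{Li}_r(x)=\sum_{k\ge1}x^k/k^r$ for $|x|<1$, extended analytically to $\mathbb{C}\setminus[1,\infty)$ by $\mathrm{Li}_r(x)=-\int_{0\le t_1\le\dots\le t_r\le1}\frac{dt_1}{t_1-1/x}\frac{dt_2}{t_2}\cdots\frac{dt_r}{t_r}$ (integration over the real segment). For real $a\ne0$ and complex $x$: $\mathcal{L}^a_r(x):=\mathrm{Li}_r(xa)-\mathrm{Li}_r(-xa)$. Here $i$ is the imaginary unit. *)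

theory Defs
  imports "HOL-Analysis.Analysis" "HOL-Library.Poly_Mapping"
begin

text \<open>Polynomials over the complex numbers in variables indexed by \<open>'n\<close>: finitely supported maps
  from monomials (exponent vectors) to coefficients, with the ring structure of
  \<^theory>\<open>HOL-Library.Poly_Mapping\<close>.\<close>

type_synonym 'n mpoly = "('n \<Rightarrow>\<^sub>0 nat) \<Rightarrow>\<^sub>0 complex"

definition mpoly_var :: "'n \<Rightarrow> 'n mpoly" where
  "mpoly_var v = Poly_Mapping.single (Poly_Mapping.single v 1) 1"

definition mpoly_const :: "complex \<Rightarrow> 'n mpoly" where
  "mpoly_const c = Poly_Mapping.single 0 c"

definition mpoly_eval :: "'n mpoly \<Rightarrow> ('n \<Rightarrow> complex) \<Rightarrow> complex" where
  "mpoly_eval P x =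
     (\<Sum>m\<in>Poly_Mapping.keys P. Poly_Mapping.lookup P m *
        (\<Prod>v\<in>Poly_Mapping.keys m. x v ^ Poly_Mapping.lookup m v))"

text \<open>The torus is parametrised by \<open>x\<^sub>v = exp (i \<theta>\<^sub>v)\<close> with \<open>0 \<le> \<theta>\<^sub>v \<le> 2 \<pi>\<close>, so that
  \<open>dx\<^sub>v / x\<^sub>v = i d\<theta>\<^sub>v\<close> and the normalisation \<open>1 / (2 \<pi> i)\<^sup>n\<close> becomes \<open>1 / (2 \<pi>)\<^sup>n\<close>.
  The number of variables is \<open>n = CARD('n)\<close>. The value at the zero polynomial is meaningless.\<close>

definition mahler_measure :: "'n::finite mpoly \<Rightarrow> real" where
  "mahler_measure P = 1 / (2 * pi) ^ CARD('n) *
     (LINT \<theta>:(UNIV \<rightarrow> {0..2*pi})|(\<Pi>\<^sub>M v\<in>(UNIV :: 'n set). lborel).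
        ln (cmod (mpoly_eval P (\<lambda>v. cis (\<theta> v)))))"

text \<open>The polylogarithm for \<open>r \<ge> 1\<close> on the complex plane without \<open>[1,\<infinity>)\<close>: the power series inside
  the unit disc, and outside it the analytic continuation, given by an integral over the real
  simplex \<open>0 \<le> t\<^sub>1 \<le> \<dots> \<le> t\<^sub>r \<le> 1\<close>. On \<open>[1,\<infinity>)\<close> the value is meaningless.\<close>

definition polylog :: "nat \<Rightarrow> complex \<Rightarrow> complex" where
  "polylog r x =
     (if cmod x < 1 then suminf (\<lambda>k. x ^ Suc k / of_nat (Suc k) ^ r)
      else - (LINT t:{t. mono_on {1..r} t \<and> t ` {1..r} \<subseteq> {0..1}}|(\<Pi>\<^sub>M j\<in>{1..r}. lborel).
                1 / (complex_of_real (t 1) - 1 / x) * (\<Prod>j\<in>{2..r}. 1 / complex_of_real (t j))))"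

definition polylog_diff :: "real \<Rightarrow> nat \<Rightarrow> complex \<Rightarrow> complex" where
  "polylog_diff a r x = polylog r (x * of_real a) - polylog r (- x * of_real a)"

end

theory Submission
  imports Defs
begin

text \<open>
  Write the polynomial as \<open>(1 + a y) + (1 - a y) x\<close> and integrate over \<open>x\<close> first. By Jensen's formula
  the mean of \<open>ln \<bar>A + B x\<bar>\<close> over the unit circle is \<open>ln (max \<bar>A\<bar> \<bar>B\<bar>)\<close>
  (\<open>has_integral_ln_cmod_circle\<close>), so with \<open>y = exp (i u)\<close> there remains
  \<open>ln (max \<bar>1 + a y\<bar> \<bar>1 - a y\<bar>)\<close>, a bounded continuous function of \<open>u\<close>. It equals
  \<open>ln \<bar>1 + a y\<bar>\<close> where \<open>cos u \<ge> 0\<close> and \<open>ln \<bar>1 - a y\<bar>\<close> where \<open>cos u \<le> 0\<close>, which are the real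
  parts of principal logarithms of numbers in the half-plane \<open>Re z \<ge> 1\<close>. Integrating over \<open>y\<close> first
  would lead instead to \<open>ln \<bar>1 + x\<bar>\<close> and \<open>ln \<bar>1 - x\<bar>\<close> on complementary arcs, whose evaluation
  passes through the singularities of these functions.

  Both circle integrals come from one identity (\<open>integral_Ln_arc\<close>):
  \<open>\<integral>\<^sub>\<alpha>\<^sup>\<beta> Ln (1 + c exp (i \<theta>)) d\<theta> = \<integral>\<^sub>0\<^sup>1 (Ln (1 + s c exp (i \<beta>)) - Ln (1 + s c exp (i \<alpha>))) / (i s) ds\<close>,
  obtained by integrating \<open>c exp (i \<theta>) / (1 + s c exp (i \<theta>))\<close> in the two possible orders. On a full
  circle the right-hand side is zero, which is Jensen's formula. On the arcs that end at \<open>\<plusminus> i\<close>, where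
  the maximum changes from one argument to the other, it gives
  \<open>\<integral>\<^sub>0\<^sup>1 (Ln (1 + i a s) - Ln (1 - i a s)) / (i s) ds\<close>.

  The dilogarithm is \<open>Li\<^sub>2(x) = - \<integral>\<^sub>0\<^sup>1 Ln (1 - x t) / t dt\<close> on the whole plane cut along \<open>[1, \<infinity>)\<close>
  (\<open>polylog_2_has_integral\<close>), from the power series inside the unit disc and from the inner
  integral over the simplex outside it. Hence the integral above is \<open>- i (Li\<^sub>2(i a) - Li\<^sub>2(- i a))\<close>.

  The iterated integrals stand for integrals over a product space, in two places: the torus and the
  simplex. Fubini's theorem (\<open>has_bochner_integral_PiM_two\<close>) needs absolute integrability, which for
  \<open>ln \<bar>P\<bar>\<close> on the torus is not evident since \<open>P\<close> has zeros there. It follows from Jensen's formula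
  itself: the bound \<open>\<bar>ln w\<bar> \<le> 2 w - ln w\<close> reduces the integral of \<open>\<bar>ln \<bar>P\<bar>\<bar>\<close> in \<open>x\<close> to that of
  \<open>ln \<bar>P\<bar>\<close>, whose value is non-negative.
\<close>

section \<open>Integration over a product of two factors\<close>

text \<open>The torus and the simplex are subsets of a product indexed by two elements. Transporting the
  binary product measure to it makes the two-variable Fubini theorem applicable.\<close>
lemma distr_pair_PiM_two:
  assumes M: "sigma_finite_measure M" and ij: "i \<noteq> j"
  shows "distr (M \<Otimes>\<^sub>M M) (\<Pi>\<^sub>M k\<in>{i, j}. M) (\<lambda>(u, v). \<lambda>k\<in>{i, j}. if k = i then u else v)
       = (\<Pi>\<^sub>M k\<in>{i, j}. M)"
proof -
  interpret M: sigma_finite_measure M by fact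
  interpret P: product_sigma_finite "\<lambda>_. M"
    unfolding product_sigma_finite_def using M by simp
  let ?pt = "\<lambda>(u, v). \<lambda>k\<in>{i, j}. if k = i then u else v"
  have meas [measurable]: "?pt \<in> measurable (M \<Otimes>\<^sub>M M) (\<Pi>\<^sub>M k\<in>{i, j}. M)"
    unfolding split_beta by (rule measurable_restrict) auto
  show ?thesis
  proof (rule P.PiM_eqI)
    fix A assume A: "\<And>k. k \<in> {i, j} \<Longrightarrow> A k \<in> sets M"
    then have [measurable]: "A i \<in> sets M" "A j \<in> sets M" by auto
    have "?pt -` Pi\<^sub>E {i, j} A \<inter> space (M \<Otimes>\<^sub>M M) = A i \<times> A j"
      using ij A[THEN sets.sets_into_space]
      by (auto simp: PiE_iff space_pair_measure split: if_splits)
    moreover have "Pi\<^sub>E {i, j} A \<in> sets (\<Pi>\<^sub>M k\<in>{i, j}. M)"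
      using A by (intro sets_PiM_I_finite) auto
    ultimately show "emeasure (distr (M \<Otimes>\<^sub>M M) (\<Pi>\<^sub>M k\<in>{i, j}. M) ?pt) (Pi\<^sub>E {i, j} A)
        = (\<Prod>k\<in>{i, j}. emeasure M (A k))"
      using ij by (simp add: emeasure_distr M.emeasure_pair_measure_Times)
  qed auto
qed

text \<open>Fubini's theorem in the form needed for functions with singularities: it is enough
  that the L1 norms of the sections are bounded uniformly in \<open>u\<close> and vanish for \<open>u\<close> outside a set
  of finite measure.
  The outer variable is the coordinate \<open>i\<close>.\<close>
lemma has_bochner_integral_PiM_two:
  fixes g :: "'a \<Rightarrow> 'a \<Rightarrow> 'b :: {banach, second_countable_topology}"
  assumes M: "sigma_finite_measure M" and ij: "i \<noteq> j"
    and meas [measurable]: "case_prod g \<in> borel_measurable (M \<Otimes>\<^sub>M M)"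
    and sections: "AE u in M. integrable M (g u)"
    and A [measurable]: "A \<in> sets M" and fin: "emeasure M A < \<infinity>"
    and bound: "AE u in M. (\<integral>v. norm (g u v) \<partial>M) \<le> K * indicator A u"
  shows "has_bochner_integral M (\<lambda>u. \<integral>v. g u v \<partial>M)
           (\<integral>t. g (t i) (t j) \<partial>(\<Pi>\<^sub>M k\<in>{i, j}. M))"
proof -
  interpret M: sigma_finite_measure M by fact
  interpret Q: pair_sigma_finite M M ..
  let ?pt = "\<lambda>(u, v). \<lambda>k\<in>{i, j}. if k = i then u else v"
  have pt [measurable]: "?pt \<in> measurable (M \<Otimes>\<^sub>M M) (\<Pi>\<^sub>M k\<in>{i, j}. M)"
    unfolding split_beta by (rule measurable_restrict) auto
  have [measurable]: "(\<lambda>t. g (t i) (t j)) \<in> borel_measurable (\<Pi>\<^sub>M k\<in>{i, j}. M)"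
  proof -
    have "(\<lambda>t. case_prod g (t i, t j)) \<in> borel_measurable (\<Pi>\<^sub>M k\<in>{i, j}. M)"
      by measurable
    then show ?thesis by simp
  qed
  have norm_int: "integrable M (\<lambda>u. \<integral>v. norm (g u v) \<partial>M)"
  proof (rule Bochner_Integration.integrable_bound)
    show "integrable M (\<lambda>u. K * indicator A u)"
      using fin by simp
    show "AE u in M. norm (\<integral>v. norm (g u v) \<partial>M) \<le> norm (K * indicator A u :: real)"
      using bound by eventually_elim (auto simp: abs_of_nonneg)
  qed measurable
  have int: "integrable (M \<Otimes>\<^sub>M M) (case_prod g)"
    using sections norm_int by (intro Q.Fubini_integrable) auto
  have "(\<integral>t. g (t i) (t j) \<partial>(\<Pi>\<^sub>M k\<in>{i, j}. M)) = (\<integral>z. case_prod g z \<partial>(M \<Otimes>\<^sub>M M))"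
    by (subst distr_pair_PiM_two[OF M ij, symmetric])
       (use ij in \<open>auto simp: integral_distr split_beta intro!: Bochner_Integration.integral_cong\<close>)
  also have "\<dots> = (\<integral>u. \<integral>v. g u v \<partial>M \<partial>M)"
    using Q.integral_fst'[OF int] by simp
  finally show ?thesis
    using Q.integrable_fst'[OF int] by (simp add: has_bochner_integral_iff)
qed

lemma has_bochner_integral_lborel_imp_has_integral:
  fixes f :: "'a::euclidean_space \<Rightarrow> 'b::euclidean_space"
  assumes "has_bochner_integral lborel f I" and zero: "\<And>u. u \<notin> S \<Longrightarrow> f u = 0"
  shows "(f has_integral I) S"
proof -
  have "integrable lborel f" "integral\<^sup>L lborel f = I"
    using assms(1) by (simp_all add: has_bochner_integral_iff)
  with has_integral_integral_lborel[of f] have "(f has_integral I) UNIV"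
    by simp
  moreover have "(\<lambda>u. if u \<in> S then f u else 0) = f"
    using zero by auto
  ultimately show ?thesis
    using has_integral_restrict_UNIV[of S f I] by simp
qed

section \<open>The logarithm along circular arcs\<close>

text \<open>The derivative of \<open>Ln (1 + s c exp (i \<theta>))\<close> in \<open>\<theta>\<close> is \<open>i s\<close> times its derivative in \<open>s\<close>. So
  the double integral of \<open>g = c exp (i \<theta>) / (1 + s c exp (i \<theta>))\<close> can be evaluated by the
  fundamental theorem of calculus in either order. The hypothesis keeps \<open>1 + z\<close> off the branch
  cut of the logarithm for all \<open>z\<close> in the circular sector. At \<open>s = 0\<close> the
  integrand on the left has the default value of a division by zero, which does not affect the integral.\<close>
lemma integral_Ln_arc:
  fixes c :: complex and \<alpha> \<beta> :: real
  assumes ab: "\<alpha> \<le> \<beta>"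
    and cut: "\<And>s \<theta>. s \<in> {0..1} \<Longrightarrow> \<theta> \<in> {\<alpha>..\<beta>} \<Longrightarrow> 1 + of_real s * (c * cis \<theta>) \<notin> \<real>\<^sub>\<le>\<^sub>0"
  shows "((\<lambda>s. (Ln (1 + of_real s * (c * cis \<beta>)) - Ln (1 + of_real s * (c * cis \<alpha>))) / (\<i> * of_real s))
           has_integral integral {\<alpha>..\<beta>} (\<lambda>\<theta>. Ln (1 + c * cis \<theta>))) {0..1}"
proof -
  define g where "g s \<theta> = c * cis \<theta> / (1 + of_real s * (c * cis \<theta>))" for s \<theta>
  have nz: "1 + of_real s * (c * cis \<theta>) \<noteq> 0" if "s \<in> {0..1}" "\<theta> \<in> {\<alpha>..\<beta>}" for s \<theta>
    using cut[OF that] by auto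
  have cont: "continuous_on ({0..1} \<times> {\<alpha>..\<beta>}) (\<lambda>(s, \<theta>). g s \<theta>)"
    unfolding g_def split_beta
    by (intro continuous_intros) (use nz in auto)
  have radial: "integral {0..1} (\<lambda>s. g s \<theta>) = Ln (1 + c * cis \<theta>)" if th: "\<theta> \<in> {\<alpha>..\<beta>}" for \<theta>
  proof -
    have "((\<lambda>s. g s \<theta>) has_integral
             Ln (1 + of_real 1 * (c * cis \<theta>)) - Ln (1 + of_real 0 * (c * cis \<theta>))) {0..1}"
    proof (rule fundamental_theorem_of_calculus)
      fix s :: real assume s: "s \<in> {0..1}"
      have "((\<lambda>z. Ln (1 + z * (c * cis \<theta>))) has_field_derivative g s \<theta>) (at (of_real s))"
        unfolding g_def using cut[OF s th]
        by (auto intro!: derivative_eq_intros simp: field_simps)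
      then show "((\<lambda>s. Ln (1 + of_real s * (c * cis \<theta>))) has_vector_derivative g s \<theta>) (at s within {0..1})"
        by (rule has_vector_derivative_real_field)
    qed simp
    then show ?thesis by (simp add: integral_unique)
  qed
  have angular: "integral {\<alpha>..\<beta>} (g s) =
      (Ln (1 + of_real s * (c * cis \<beta>)) - Ln (1 + of_real s * (c * cis \<alpha>))) / (\<i> * of_real s)"
    if s: "s \<in> {0..1}" "s \<noteq> 0" for s
  proof -
    have "(g s has_integral Ln (1 + of_real s * (c * cis \<beta>)) / (\<i> * of_real s)
             - Ln (1 + of_real s * (c * cis \<alpha>)) / (\<i> * of_real s)) {\<alpha>..\<beta>}"
    proof (rule fundamental_theorem_of_calculus[OF ab])
      fix \<theta> assume th: "\<theta> \<in> {\<alpha>..\<beta>}"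
      define e where "e = exp (\<i> * of_real \<theta>)"
      define w where "w = 1 + of_real s * (c * e)"
      have w: "w \<notin> \<real>\<^sub>\<le>\<^sub>0" "w \<noteq> 0"
        using cut[OF s(1) th] nz[OF s(1) th] by (simp_all add: w_def e_def cis_conv_exp)
      have "((\<lambda>z. Ln (1 + of_real s * (c * exp (\<i> * z)))) has_field_derivative
          inverse w * (of_real s * (c * (\<i> * e)))) (at (of_real \<theta>))"
        using w(1) unfolding w_def e_def
        by (auto intro!: derivative_eq_intros simp: mult_ac)
      then have "((\<lambda>z. Ln (1 + of_real s * (c * exp (\<i> * z))) / (\<i> * of_real s))
          has_field_derivative inverse w * (of_real s * (c * (\<i> * e))) / (\<i> * of_real s)) (at (of_real \<theta>))"
        by (rule DERIV_cdivide)
      also have "inverse w * (of_real s * (c * (\<i> * e))) / (\<i> * of_real s) = c * e / w"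
        using s(2) w(2) by (simp add: field_simps)
      also have "\<dots> = g s \<theta>"
        by (simp add: g_def w_def e_def cis_conv_exp)
      finally have "((\<lambda>z. Ln (1 + of_real s * (c * exp (\<i> * z))) / (\<i> * of_real s))
          has_field_derivative g s \<theta>) (at (of_real \<theta>))" .
      then show "((\<lambda>\<theta>. Ln (1 + of_real s * (c * cis \<theta>)) / (\<i> * of_real s))
          has_vector_derivative g s \<theta>) (at \<theta> within {\<alpha>..\<beta>})"
        unfolding cis_conv_exp by (rule has_vector_derivative_real_field)
    qed
    then show ?thesis by (simp add: integral_unique diff_divide_distrib)
  qed
  have "continuous_on {0..1} (\<lambda>s. integral (cbox \<alpha> \<beta>) (g s))"
    by (rule integral_continuous_on_param) (use cont in simp)
  then have "(\<lambda>s. integral {\<alpha>..\<beta>} (g s)) integrable_on {0..1}"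
    using integrable_continuous_interval by force
  then have "((\<lambda>s. integral {\<alpha>..\<beta>} (g s)) has_integral
      integral {0..1} (\<lambda>s. integral {\<alpha>..\<beta>} (g s))) {0..1}"
    by (rule integrable_integral)
  also have "integral {0..1} (\<lambda>s. integral {\<alpha>..\<beta>} (g s))
      = integral {\<alpha>..\<beta>} (\<lambda>\<theta>. integral {0..1} (\<lambda>s. g s \<theta>))"
    using integral_swap_continuous[of 0 \<alpha> 1 \<beta> g] cont by (simp add: cbox_Pair_eq)
  also have "\<dots> = integral {\<alpha>..\<beta>} (\<lambda>\<theta>. Ln (1 + c * cis \<theta>))"
    using radial by (rule integral_cong)
  finally show ?thesis
    by (rule has_integral_spike_finite[of "{0}", rotated 2]) (use angular in auto)
qed

lemma Re_pos_not_nonpos_Reals: "Re z > 0 \<Longrightarrow> z \<notin> \<real>\<^sub>\<le>\<^sub>0"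
  by (auto simp: complex_nonpos_Reals_iff)

lemma has_integral_ln_cmod_arc:
  assumes "\<And>\<theta>. \<theta> \<in> {\<alpha>..\<beta>} \<Longrightarrow> 1 + c * cis \<theta> \<notin> \<real>\<^sub>\<le>\<^sub>0"
  shows "((\<lambda>\<theta>. ln (cmod (1 + c * cis \<theta>))) has_integral
           Re (integral {\<alpha>..\<beta>} (\<lambda>\<theta>. Ln (1 + c * cis \<theta>)))) {\<alpha>..\<beta>}"
proof -
  have "continuous_on {\<alpha>..\<beta>} (\<lambda>\<theta>. Ln (1 + c * cis \<theta>))"
    by (intro continuous_intros) (use assms in auto)
  then have "((\<lambda>\<theta>. Ln (1 + c * cis \<theta>)) has_integral integral {\<alpha>..\<beta>} (\<lambda>\<theta>. Ln (1 + c * cis \<theta>))) {\<alpha>..\<beta>}"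
    by (intro integrable_integral integrable_continuous_interval)
  then have "((\<lambda>\<theta>. Re (Ln (1 + c * cis \<theta>))) has_integral
      Re (integral {\<alpha>..\<beta>} (\<lambda>\<theta>. Ln (1 + c * cis \<theta>)))) {\<alpha>..\<beta>}"
    by (rule has_integral_linear[OF _ bounded_linear_Re, unfolded o_def])
  then show ?thesis
    by (rule has_integral_eq[rotated]) (metis Re_Ln assms nonpos_Reals_zero_I)
qed

text \<open>Jensen's formula for a linear polynomial. If \<open>cmod B < cmod A\<close>, the factor \<open>1 + (B / A) x\<close>
  stays in the right half-plane, and \<open>integral_Ln_arc\<close> over the closed circle gives zero for it.
  The other case reduces to this one because \<open>A + B x\<close> and \<open>cnj B + cnj A x\<close> have equal modulus on
  the unit circle. The case of equal moduli, where the integrand is singular, is excluded: it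
  concerns only a null set of the outer variable.\<close>
lemma has_integral_ln_cmod_circle:
  assumes "cmod A \<noteq> cmod B"
  shows "((\<lambda>\<theta>. ln (cmod (A + B * cis \<theta>))) has_integral 2 * pi * ln (max (cmod A) (cmod B))) {0..2*pi}"
proof -
  have small: "((\<lambda>\<theta>. ln (cmod (A + B * cis \<theta>))) has_integral 2 * pi * ln (cmod A)) {0..2*pi}"
    if less: "cmod B < cmod A" for A B
  proof -
    define c where "c = B / A"
    have A: "A \<noteq> 0" using less by auto
    have c: "cmod c < 1" using less A by (simp add: c_def norm_divide)
    have cut: "1 + of_real s * (c * cis \<theta>) \<notin> \<real>\<^sub>\<le>\<^sub>0" if "s \<in> {0..1}" for s \<theta>
    proof -
      have "cmod (of_real s * (c * cis \<theta>)) < 1"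
        using that c mult_left_le_one_le[of "cmod c" s] by (simp add: norm_mult)
      then show ?thesis
        using abs_Re_le_cmod[of "of_real s * (c * cis \<theta>)"]
        by (intro Re_pos_not_nonpos_Reals) simp
    qed
    have "((\<lambda>s::real. 0) has_integral integral {0..2*pi} (\<lambda>\<theta>. Ln (1 + c * cis \<theta>))) {0..1}"
      using integral_Ln_arc[of 0 "2*pi" c] cut by simp
    then have zero: "integral {0..2*pi} (\<lambda>\<theta>. Ln (1 + c * cis \<theta>)) = 0"
      by (rule has_integral_unique) simp
    have cut1: "1 + c * cis \<theta> \<notin> \<real>\<^sub>\<le>\<^sub>0" for \<theta>
      using cut[of 1] by simp
    have "((\<lambda>\<theta>. ln (cmod (1 + c * cis \<theta>))) has_integral 0) {0..2*pi}"
      using has_integral_ln_cmod_arc[OF cut1, of 0 "2*pi"] zero by simp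
    moreover have "((\<lambda>\<theta>. ln (cmod A)) has_integral 2 * pi * ln (cmod A)) {0..2*pi}"
      using has_integral_const_real[of "ln (cmod A)" 0 "2*pi"] by simp
    ultimately have "((\<lambda>\<theta>. ln (cmod A) + ln (cmod (1 + c * cis \<theta>))) has_integral
        2 * pi * ln (cmod A) + 0) {0..2*pi}"
      by (intro has_integral_add)
    moreover have "ln (cmod (A + B * cis \<theta>)) = ln (cmod A) + ln (cmod (1 + c * cis \<theta>))" for \<theta>
    proof -
      have "A + B * cis \<theta> = A * (1 + c * cis \<theta>)"
        using A by (simp add: c_def field_simps)
      moreover have "1 + c * cis \<theta> \<noteq> 0" using cut1[of \<theta>] by auto
      ultimately show ?thesis using A by (simp add: norm_mult ln_mult)
    qed
    ultimately show ?thesis by simp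
  qed
  have swap: "cmod (A + B * cis \<theta>) = cmod (cnj B + cnj A * cis \<theta>)" for \<theta>
  proof -
    have "cmod (A + B * cis \<theta>) = cmod (cnj (cis \<theta>) * (A + B * cis \<theta>))"
      by (simp add: norm_mult)
    also have "cnj (cis \<theta>) * (A + B * cis \<theta>) = B + A * cnj (cis \<theta>)"
      using complex_norm_square[of "cis \<theta>"] by (simp add: algebra_simps)
    also have "cmod \<dots> = cmod (cnj (B + A * cnj (cis \<theta>)))"
      by (rule complex_mod_cnj[symmetric])
    finally show ?thesis by simp
  qed
  show ?thesis
  proof (cases "cmod B < cmod A")
    case True
    then show ?thesis using small[of B A] by (simp add: max_def)
  next
    case False
    with assms show ?thesis
      unfolding swap using small[of "cnj A" "cnj B"] by (simp add: max_def)
  qed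
qed

section \<open>The dilogarithm as a single integral\<close>

text \<open>The plane without the cut \<open>[1, \<infinity>)\<close> is star-shaped about the origin.\<close>
lemma one_minus_scaled_not_nonpos_Reals:
  fixes x :: complex and t :: real
  assumes "1 - x \<notin> \<real>\<^sub>\<le>\<^sub>0" "t \<in> {0..1}"
  shows "1 - of_real t * x \<notin> \<real>\<^sub>\<le>\<^sub>0"
proof
  assume "1 - of_real t * x \<in> \<real>\<^sub>\<le>\<^sub>0"
  then have 1: "t * Re x \<ge> 1" and 2: "t * Im x = 0"
    by (auto simp: complex_nonpos_Reals_iff)
  have "t \<noteq> 0" using 1 by auto
  with 2 have "Im x = 0" by simp
  moreover have "Re x \<ge> 1"
  proof (rule ccontr)
    assume "\<not> Re x \<ge> 1"
    then have "t * Re x < t * 1"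
      using assms(2) \<open>t \<noteq> 0\<close> by (intro mult_strict_left_mono) auto
    then have "t * Re x < 1" using assms(2) by simp
    with 1 show False by simp
  qed
  ultimately show False using assms(1) by (auto simp: complex_nonpos_Reals_iff)
qed

text \<open>Termwise differentiation of \<open>F(z) = \<Sum> z\<^sup>n / n\<^sup>2\<close> gives \<open>z F'(z) = - Ln (1 - z)\<close>. So
  \<open>F(t x)\<close> is an antiderivative of the integrand, except at \<open>t = 0\<close>.\<close>
lemma dilog_has_integral_disc:
  assumes x: "cmod x < 1"
  shows "((\<lambda>t. - Ln (1 - of_real t * x) / of_real t) has_integral
           suminf (\<lambda>k. x ^ Suc k / of_nat (Suc k) ^ 2)) {0..1}"
proof -
  define c :: "nat \<Rightarrow> complex" where "c n = 1 / of_nat n ^ 2" for n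
  define F where "F z = suminf (\<lambda>n. c n * z ^ n)" for z
  have c_le: "norm (c n) \<le> 1" for n
    by (cases n) (auto simp: c_def norm_divide norm_power divide_simps simp del: of_nat_Suc)
  have sm: "summable (\<lambda>n. c n * z ^ n)" if "norm z < 1" for z
  proof (rule summable_comparison_test')
    show "summable (\<lambda>n. norm z ^ n)" using that by (simp add: summable_geometric)
    show "norm (c n * z ^ n) \<le> norm z ^ n" for n
      using c_le[of n] by (simp add: norm_mult norm_power mult_left_le_one_le)
  qed
  have dF: "(F has_field_derivative suminf (\<lambda>n. diffs c n * z ^ n)) (at z)" if "norm z < 1" for z
    unfolding F_def using sm that by (rule termdiffs_strong')
  have contF: "continuous_on (ball 0 1) F"
    by (rule DERIV_continuous_on[OF has_field_derivative_at_within[OF dF]]) simp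
  have dval: "z * suminf (\<lambda>n. diffs c n * z ^ n) = - Ln (1 - z)" if z: "norm z < 1" for z
  proof -
    have "(\<lambda>n. - (z ^ n) / of_nat n) sums Ln (1 - z)"
      using Ln_series'[of "- z"] z by simp
    then have "(\<lambda>n. - (z ^ Suc n) / of_nat (Suc n)) sums Ln (1 - z)"
      using sums_Suc_iff[of "\<lambda>n. - (z ^ n) / of_nat n" "Ln (1 - z)"] by simp
    then have "(\<lambda>n. z ^ Suc n / of_nat (Suc n)) sums - Ln (1 - z)"
      using sums_minus by fastforce
    moreover have "(\<lambda>n. z * (diffs c n * z ^ n)) sums (z * suminf (\<lambda>n. diffs c n * z ^ n))"
      by (intro sums_mult summable_sums termdiff_converges[of _ 1]) (use sm z in auto)
    moreover have "z * (diffs c n * z ^ n) = z ^ Suc n / of_nat (Suc n)" for n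
      by (simp add: diffs_def c_def power2_eq_square del: of_nat_Suc)
    ultimately show ?thesis using sums_unique2 by simp
  qed
  have small: "cmod (of_real t * x) < 1" if "t \<in> {0..1}" for t
    using that x mult_left_le_one_le[of "cmod x" t] by (simp add: norm_mult)
  have "((\<lambda>t. - Ln (1 - of_real t * x) / of_real t) has_integral F (of_real 1 * x) - F (of_real 0 * x)) {0..1}"
  proof (rule fundamental_theorem_of_calculus_interior)
    show "continuous_on {0..1} (\<lambda>t. F (of_real t * x))"
      by (rule continuous_on_compose2[OF contF])
         (use small in \<open>auto intro!: continuous_intros\<close>)
    fix t :: real assume t: "t \<in> {0<..<1}"
    then have lt: "cmod (of_real t * x) < 1" by (intro small) auto
    have "((\<lambda>z. F (z * x)) has_field_derivative suminf (\<lambda>n. diffs c n * (of_real t * x) ^ n) * x) (at (of_real t))"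
      by (rule DERIV_chain2[where f = F and g = "\<lambda>z. z * x", OF dF[OF lt]]) (auto intro!: derivative_eq_intros)
    moreover have "suminf (\<lambda>n. diffs c n * (of_real t * x) ^ n) * x = - Ln (1 - of_real t * x) / of_real t"
      using dval[OF lt] t by (simp add: field_simps)
    ultimately show "((\<lambda>t. F (of_real t * x)) has_vector_derivative - Ln (1 - of_real t * x) / of_real t) (at t)"
      using has_vector_derivative_real_field by fastforce
  qed simp
  moreover have "F 0 = 0" by (simp only: F_def powser_zero) (simp add: c_def)
  moreover have "F x = suminf (\<lambda>k. x ^ Suc k / of_nat (Suc k) ^ 2)"
    unfolding F_def using suminf_split_head[OF sm[OF x]] by (simp add: c_def)
  ultimately show ?thesis by simp
qed

text \<open>For fixed \<open>t\<^sub>2 = u\<close>, the function \<open>Ln (1 - t\<^sub>1 x)\<close> is an antiderivative of \<open>1 / (t\<^sub>1 - 1/x)\<close>,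
  so the inner integral over \<open>0 \<le> t\<^sub>1 \<le> u\<close> is \<open>Ln (1 - u x) / u\<close>. Absolute integrability holds
  although \<open>1 / t\<^sub>2\<close> is singular: the inner interval has length \<open>t\<^sub>2\<close>, so the singularity cancels.\<close>
lemma dilog_has_integral_simplex:
  assumes x: "x \<noteq> 0" and cut: "1 - x \<notin> \<real>\<^sub>\<le>\<^sub>0"
  shows "((\<lambda>t. - Ln (1 - of_real t * x) / of_real t) has_integral
           - (LINT t:{t. mono_on {1..2} t \<and> t ` {1..2} \<subseteq> {0..1}}|(\<Pi>\<^sub>M j\<in>{1..2::nat}. lborel).
                1 / (complex_of_real (t 1) - 1 / x) * (\<Prod>j\<in>{2..2}. 1 / complex_of_real (t j)))) {0..1}"
proof -
  define h where "h v = 1 / (complex_of_real v - 1 / x)" for v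
  define g where "g u v = (if 0 \<le> v \<and> v \<le> u \<and> u \<le> 1 then h v * (1 / of_real u) else 0)" for u v :: real
  have cutt: "1 - of_real t * x \<notin> \<real>\<^sub>\<le>\<^sub>0" if "t \<in> {0..1}" for t :: real
    using one_minus_scaled_not_nonpos_Reals[OF cut that] .
  have nz: "complex_of_real v - 1 / x \<noteq> 0" if "v \<in> {0..1}" for v
    using cutt[OF that] x by (auto simp: field_simps)
  have conth: "continuous_on {0..1} h"
    unfolding h_def by (intro continuous_intros) (use nz in auto)
  have "bounded (h ` {0..1})"
    using conth by (intro compact_imp_bounded compact_continuous_image) auto
  then obtain K where K: "\<And>v. v \<in> {0..1} \<Longrightarrow> norm (h v) \<le> K"
    unfolding bounded_iff by (meson imageI)
  have K0: "0 \<le> K" using order_trans[OF norm_ge_zero K[of 0]] by simp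
  have g_eq: "g u = (\<lambda>v. indicator {0..u} v *\<^sub>R (h v * (1 / of_real u)))" if "u \<in> {0..1}" for u
    using that by (auto simp: g_def fun_eq_iff)
  have g_0: "g u = (\<lambda>v. 0)" if "u \<notin> {0..1}" for u
    using that by (auto simp: g_def fun_eq_iff)
  have int_set: "set_integrable lborel {0..u} (\<lambda>v. h v * (1 / of_real u))" if "u \<in> {0..1}" for u
    by (intro borel_integrable_atLeastAtMost' continuous_on_mult continuous_on_const
          continuous_on_subset[OF conth]) (use that in auto)
  have int: "integrable lborel (g u)" for u
    using int_set[of u] g_eq[of u] g_0[of u]
    by (cases "u \<in> {0..1}") (auto simp: set_integrable_def)
  have inner: "(LINT v|lborel. g u v) = Ln (1 - of_real u * x) / of_real u" if u: "u \<in> {0..1}" for u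
  proof -
    have "(h has_integral Ln (1 - of_real u * x) - Ln (1 - of_real 0 * x)) {0..u}"
    proof (rule fundamental_theorem_of_calculus)
      fix v assume "v \<in> {0..u}"
      then have v: "v \<in> {0..1}" using u by auto
      have "((\<lambda>z. Ln (1 - z * x)) has_field_derivative - x / (1 - of_real v * x)) (at (of_real v))"
        using cutt[OF v] by (auto intro!: derivative_eq_intros simp: divide_inverse)
      also have "- x / (1 - of_real v * x) = h v"
        using nz[OF v] x unfolding h_def by (auto simp: field_simps)
      finally show "((\<lambda>v. Ln (1 - of_real v * x)) has_vector_derivative h v) (at v within {0..u})"
        by (rule has_vector_derivative_real_field)
    qed (use u in auto)
    then have "((\<lambda>v. h v * (1 / of_real u)) has_integral Ln (1 - of_real u * x) * (1 / of_real u)) {0..u}"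
      by (intro has_integral_mult_left) simp
    moreover have "(LINT v|lborel. g u v) = integral {0..u} (\<lambda>v. h v * (1 / of_real u))"
      using set_borel_integral_eq_integral(2)[OF int_set[OF u]]
      unfolding g_eq[OF u] set_lebesgue_integral_def .
    ultimately show ?thesis by (simp only: integral_unique mult_1_right times_divide_eq_right)
  qed
  have bound: "(LINT v|lborel. norm (g u v)) \<le> K * indicator {0..1} u" for u
  proof (cases "u \<in> {0..1}")
    case True
    have "(LINT v|lborel. norm (g u v)) \<le> (LINT v|lborel. indicator {0..u} v * (K / u))"
    proof (rule integral_mono)
      show "integrable lborel (\<lambda>v. indicator {0..u} v * (K / u))"
        by (intro integrable_mult_left) (simp add: emeasure_lborel_Icc_eq)
      show "norm (g u v) \<le> indicator {0..u} v * (K / u)" for v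
        using True K[of v]
        by (auto simp: g_eq indicator_def norm_mult norm_divide intro!: divide_right_mono)
    qed (use int in simp)
    also have "\<dots> \<le> K" using True K0 by (simp add: measure_def)
    finally show ?thesis using True by simp
  qed (simp add: g_0)
  have [measurable]: "h \<in> borel_measurable borel" unfolding h_def by measurable
  have "has_bochner_integral lborel (\<lambda>u. LINT v|lborel. g u v)
          (LINT t|(\<Pi>\<^sub>M k\<in>{2, 1::nat}. lborel). g (t 2) (t 1))"
  proof (rule has_bochner_integral_PiM_two)
    show "case_prod g \<in> borel_measurable (lborel \<Otimes>\<^sub>M lborel)"
      unfolding g_def split_beta by measurable
    show "sigma_finite_measure (lborel :: real measure)" ..
    show "AE u in lborel. (LINT v|lborel. norm (g u v)) \<le> K * indicator {0..1} u"
      using bound by simp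
  qed (use int in auto)
  then have "((\<lambda>u. LINT v|lborel. g u v) has_integral
      (LINT t|(\<Pi>\<^sub>M k\<in>{2, 1::nat}. lborel). g (t 2) (t 1))) {0..1}"
    by (rule has_bochner_integral_lborel_imp_has_integral) (simp add: g_0)
  then have "((\<lambda>u. Ln (1 - of_real u * x) / of_real u) has_integral
      (LINT t|(\<Pi>\<^sub>M k\<in>{2, 1::nat}. lborel). g (t 2) (t 1))) {0..1}"
    by (rule has_integral_eq[rotated]) (rule inner)
  moreover have "(LINT t|(\<Pi>\<^sub>M k\<in>{2, 1::nat}. lborel). g (t 2) (t 1)) =
      (LINT t:{t. mono_on {1..2} t \<and> t ` {1..2} \<subseteq> {0..1}}|(\<Pi>\<^sub>M j\<in>{1..2::nat}. lborel).
                1 / (complex_of_real (t 1) - 1 / x) * (\<Prod>j\<in>{2..2}. 1 / complex_of_real (t j)))"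
  proof -
    have two: "{1..2::nat} = {2, 1}" by auto
    have "mono_on {1..2} t \<and> t ` {1..2} \<subseteq> {0..1} \<longleftrightarrow> 0 \<le> t 1 \<and> t 1 \<le> t 2 \<and> t 2 \<le> 1" for t :: "nat \<Rightarrow> real"
      unfolding two by (auto simp: mono_on_def)
    then show ?thesis
      unfolding set_lebesgue_integral_def two
      by (intro Bochner_Integration.integral_cong) (auto simp: g_def h_def indicator_def)
  qed
  ultimately show ?thesis
    by (auto dest: has_integral_neg)
qed

lemma polylog_2_has_integral:
  assumes "1 - x \<notin> \<real>\<^sub>\<le>\<^sub>0"
  shows "((\<lambda>t. - Ln (1 - of_real t * x) / of_real t) has_integral polylog 2 x) {0..1}"
proof (cases "cmod x < 1")
  case True
  then show ?thesis using dilog_has_integral_disc by (simp add: polylog_def)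
next
  case False
  then have "x \<noteq> 0" by auto
  from dilog_has_integral_simplex[OF this assms] show ?thesis
    by (simp only: polylog_def False if_False)
qed

section \<open>Evaluation of polynomials\<close>

text \<open>Summing over a fixed superset of the monomials, and multiplying over all variables, makes
  evaluation visibly additive.\<close>
lemma mpoly_eval_superset:
  fixes P :: "'n::finite mpoly"
  assumes "finite S" "Poly_Mapping.keys P \<subseteq> S"
  shows "mpoly_eval P z = (\<Sum>m\<in>S. Poly_Mapping.lookup P m * (\<Prod>v\<in>UNIV. z v ^ Poly_Mapping.lookup m v))"
proof -
  have "(\<Prod>v\<in>Poly_Mapping.keys m. z v ^ Poly_Mapping.lookup m v) = (\<Prod>v\<in>UNIV. z v ^ Poly_Mapping.lookup m v)"
    for m :: "'n \<Rightarrow>\<^sub>0 nat"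
    by (rule prod.mono_neutral_left) (auto simp: in_keys_iff)
  then show ?thesis
    unfolding mpoly_eval_def using assms by (auto intro!: sum.mono_neutral_left simp: in_keys_iff)
qed

lemma mpoly_eval_add:
  fixes P Q :: "'n::finite mpoly"
  shows "mpoly_eval (P + Q) z = mpoly_eval P z + mpoly_eval Q z"
proof -
  let ?S = "Poly_Mapping.keys P \<union> Poly_Mapping.keys Q"
  have "Poly_Mapping.keys (P + Q) \<subseteq> ?S" by (rule Poly_Mapping.keys_add)
  then show ?thesis
    by (simp add: mpoly_eval_superset[of ?S] lookup_add distrib_right sum.distrib)
qed

lemma mpoly_eval_single:
  fixes m :: "'n::finite \<Rightarrow>\<^sub>0 nat"
  shows "mpoly_eval (Poly_Mapping.single m c) z = c * (\<Prod>v\<in>UNIV. z v ^ Poly_Mapping.lookup m v)"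
  by (subst mpoly_eval_superset[of "{m}"]) auto

lemma UNIV_2: "(UNIV :: 2 set) = {2, 1}"
  using exhaust_2 by auto

text \<open>The value is arranged as a linear polynomial in the first variable, the one over which the
  integration is done first. The index type \<open>2\<close> consists of residues modulo two, so the index
  \<open>2\<close> is the residue \<open>0\<close> and differs from \<open>1\<close>.\<close>
lemma mpoly_eval_bilinear:
  "mpoly_eval ((1 + mpoly_var 1) + mpoly_const c * (1 - mpoly_var 1) * mpoly_var (2::2)) z
     = (1 + c * z 2) + (1 - c * z 2) * z 1"
proof -
  have eq: "(1 + mpoly_var 1) + mpoly_const c * (1 - mpoly_var 1) * mpoly_var (2::2)
      = Poly_Mapping.single 0 1 + Poly_Mapping.single (Poly_Mapping.single 1 1) 1
        + Poly_Mapping.single (Poly_Mapping.single 2 1) c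
        + Poly_Mapping.single (Poly_Mapping.single 1 1 + Poly_Mapping.single 2 1) (- c)"
    by (simp add: mpoly_var_def mpoly_const_def algebra_simps mult_single single_uminus)
  show ?thesis
    unfolding eq mpoly_eval_add mpoly_eval_single UNIV_2
    by (simp add: lookup_add lookup_single when_def algebra_simps)
qed

section \<open>The Mahler measure\<close>

text \<open>The linear term absorbs the positive part of the logarithm, so that upper bounds on \<open>w\<close>
  together with a lower bound for an integral of \<open>ln w\<close> control the integral of \<open>\<bar>ln w\<bar>\<close>.\<close>
lemma abs_ln_le: "\<bar>ln w\<bar> \<le> 2 * w - ln w" if "0 < w" for w :: real
  using ln_le_minus_one[OF that] that by (cases "1 \<le> w") (auto simp: abs_if)

text \<open>Jensen's formula in the inner variable, for a polynomial that is linear in it. The lower bound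
  on the maximum makes the inner integral of \<open>ln \<bar>A + B x\<bar>\<close> non-negative, which together with
  \<open>abs_ln_le\<close> bounds the inner integral of the absolute value by \<open>2 \<pi> \<cdot> 2 C\<close>. The set
  \<open>N\<close> contains the parameters at which the polynomial may vanish on the circle.\<close>
lemma integral_torus_ln_cmod:
  fixes A B :: "real \<Rightarrow> complex"
  assumes meas [measurable]: "A \<in> borel_measurable borel" "B \<in> borel_measurable borel"
    and ij: "i \<noteq> j" and N: "finite N"
    and neq: "\<And>u. u \<in> {0..2*pi} - N \<Longrightarrow> cmod (A u) \<noteq> cmod (B u)"
    and lower: "\<And>u. u \<in> {0..2*pi} - N \<Longrightarrow> 1 \<le> max (cmod (A u)) (cmod (B u))"
    and upper: "\<And>u. cmod (A u) + cmod (B u) \<le> C"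
  shows "((\<lambda>u. 2 * pi * ln (max (cmod (A u)) (cmod (B u)))) has_integral
           (LINT \<theta>|(\<Pi>\<^sub>M k\<in>{i, j}. lborel). indicator {0..2*pi} (\<theta> i) * indicator {0..2*pi} (\<theta> j) *
              ln (cmod (A (\<theta> i) + B (\<theta> i) * cis (\<theta> j))))) {0..2*pi}"
proof -
  define f where "f u v = ln (cmod (A u + B u * cis v))" for u v
  define g :: "real \<Rightarrow> real \<Rightarrow> real"
    where "g u v = indicator {0..2*pi} u * indicator {0..2*pi} v * f u v" for u v
  have C0: "0 \<le> C" using upper[of 0] by (smt (verit) norm_ge_zero)
  have nz: "A u + B u * cis v \<noteq> 0" if "u \<in> {0..2*pi} - N" for u v
  proof
    assume "A u + B u * cis v = 0"
    then have "A u = - (B u * cis v)" by (simp add: eq_neg_iff_add_eq_0)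
    then have "cmod (A u) = cmod (B u)" by (simp add: norm_mult)
    with neq[OF that] show False by contradiction
  qed
  have int_f: "set_integrable lborel {0..2*pi} (f u)" if u: "u \<in> {0..2*pi} - N" for u
    unfolding f_def by (intro borel_integrable_atLeastAtMost' continuous_intros) (use nz[OF u] in auto)
  have val_f: "(LINT v:{0..2*pi}|lborel. f u v) = 2 * pi * ln (max (cmod (A u)) (cmod (B u)))"
    if u: "u \<in> {0..2*pi} - N" for u
  proof -
    have "(f u has_integral 2 * pi * ln (max (cmod (A u)) (cmod (B u)))) {0..2*pi}"
      using has_integral_ln_cmod_circle[OF neq[OF u]] by (simp add: f_def[abs_def])
    with set_borel_integral_eq_integral(2)[OF int_f[OF u]] show ?thesis
      by (simp add: integral_unique)
  qed
  have g_eq: "g u = (\<lambda>v. indicator {0..2*pi} v *\<^sub>R f u v)" if "u \<in> {0..2*pi}" for u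
    using that by (simp add: g_def fun_eq_iff)
  have g_0: "g u = (\<lambda>v. 0)" if "u \<notin> {0..2*pi}" for u
    using that by (simp add: g_def fun_eq_iff)
  have int: "integrable lborel (g u)" if "u \<notin> N" for u
    using int_f[of u] g_eq[of u] g_0[of u] that
    by (cases "u \<in> {0..2*pi}") (auto simp: set_integrable_def)
  have bound: "(LINT v|lborel. norm (g u v)) \<le> 4 * pi * C * indicator {0..2*pi} u" if "u \<notin> N" for u
  proof (cases "u \<in> {0..2*pi}")
    case True
    with that have u: "u \<in> {0..2*pi} - N" by simp
    have pw: "\<bar>f u v\<bar> \<le> 2 * C - f u v" for v
    proof -
      have "cmod (A u + B u * cis v) \<le> C"
        using norm_triangle_ineq[of "A u" "B u * cis v"] upper[of u] by (simp add: norm_mult)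
      then show ?thesis
        using abs_ln_le[of "cmod (A u + B u * cis v)"] nz[OF u, of v] by (simp add: f_def)
    qed
    have const: "set_integrable lborel {0..2*pi} (\<lambda>v. 2 * C)"
      by (intro borel_integrable_atLeastAtMost' continuous_intros)
    have "(LINT v|lborel. norm (g u v)) = (LINT v:{0..2*pi}|lborel. \<bar>f u v\<bar>)"
      using True by (simp add: g_eq set_lebesgue_integral_def abs_mult)
    also have "\<dots> \<le> (LINT v:{0..2*pi}|lborel. 2 * C - f u v)"
      by (intro set_integral_mono set_integrable_abs int_f set_integral_diff const u pw)
    also have "\<dots> = (LINT v:{0..2*pi}|lborel. 2 * C) - 2 * pi * ln (max (cmod (A u)) (cmod (B u)))"
      using set_integral_diff(2)[OF const int_f[OF u]] val_f[OF u] by (simp only:)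
    also have "\<dots> \<le> (LINT v:{0..2*pi}|lborel. 2 * C)"
      using lower[OF u] by simp
    also have "\<dots> = 4 * pi * C"
      by (simp add: set_lebesgue_integral_def measure_def)
    finally show ?thesis using True by simp
  qed (simp add: g_0)
  have null: "AE u in lborel. u \<notin> N"
    using AE_not_in[OF finite_imp_null_set_lborel[OF N]] .
  have "has_bochner_integral lborel (\<lambda>u. LINT v|lborel. g u v)
          (LINT \<theta>|(\<Pi>\<^sub>M k\<in>{i, j}. lborel). g (\<theta> i) (\<theta> j))"
  proof (rule has_bochner_integral_PiM_two[OF _ ij])
    show "case_prod g \<in> borel_measurable (lborel \<Otimes>\<^sub>M lborel)"
    proof -
      have [measurable]: "cis \<in> borel_measurable borel"
        by (intro borel_measurable_continuous_onI continuous_intros)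
      show ?thesis unfolding g_def f_def split_beta by measurable
    qed
    show "sigma_finite_measure (lborel :: real measure)" ..
    show "AE u in lborel. integrable lborel (g u)"
      using null by eventually_elim (rule int)
    show "AE u in lborel. (LINT v|lborel. norm (g u v)) \<le> 4 * pi * C * indicator {0..2*pi} u"
      using null by eventually_elim (rule bound)
  qed auto
  then have "((\<lambda>u. LINT v|lborel. g u v) has_integral
      (LINT \<theta>|(\<Pi>\<^sub>M k\<in>{i, j}. lborel). g (\<theta> i) (\<theta> j))) {0..2*pi}"
    by (rule has_bochner_integral_lborel_imp_has_integral) (simp add: g_0)
  then have "((\<lambda>u. 2 * pi * ln (max (cmod (A u)) (cmod (B u)))) has_integral
      (LINT \<theta>|(\<Pi>\<^sub>M k\<in>{i, j}. lborel). g (\<theta> i) (\<theta> j))) {0..2*pi}"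
    by (rule has_integral_spike[OF negligible_finite[OF N], rotated])
       (use val_f in \<open>simp add: g_eq set_lebesgue_integral_def\<close>)
  then show ?thesis by (simp add: g_def f_def)
qed

text \<open>The two moduli are compared through their squares: the sum of the squares is \<open>2 + 2 a\<^sup>2\<close>, so
  the larger modulus is at least 1, and their difference has the sign of \<open>a cos u\<close>.\<close>
lemma cmod_one_plus_squared:
  "(cmod (1 + of_real a * cis u))\<^sup>2 = 1 + a\<^sup>2 + 2 * a * cos u"
proof -
  have "(cmod (1 + of_real a * cis u))\<^sup>2 = 1 + a\<^sup>2 * ((sin u)\<^sup>2 + (cos u)\<^sup>2) + 2 * a * cos u"
    by (simp add: cmod_power2 power2_sum power_mult_distrib distrib_left del: sin_cos_squared_add)
  then show ?thesis by simp
qed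

lemma cmod_one_minus_squared:
  "(cmod (1 - of_real a * cis u))\<^sup>2 = 1 + a\<^sup>2 - 2 * a * cos u"
  using cmod_one_plus_squared[of "- a" u] by simp

text \<open>The circle is cut at \<open>\<pi>/2\<close> and \<open>3\<pi>/2\<close>, where the two moduli agree, and at the base point
  \<open>0\<close>. On each of the three arcs the larger modulus is \<open>\<bar>1 + b exp (i u)\<bar>\<close> for a constant
  \<open>b = \<plusminus> a\<close>. Adding the three instances of \<open>integral_Ln_arc\<close>, the terms at the base point cancel and
  those at \<open>\<plusminus> i\<close> occur twice. The second claim holds because the integrand that represents
  \<open>Li\<^sub>2(i a) - Li\<^sub>2(- i a)\<close> is a difference of complex conjugates, divided by a real number.\<close>
lemma has_integral_ln_max_cmod:
  assumes a: "0 < a"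
  shows "((\<lambda>u. ln (max (cmod (1 + of_real a * cis u)) (cmod (1 - of_real a * cis u)))) has_integral
            2 * Re (- \<i> * polylog_diff a 2 \<i>)) {0..2*pi}"
    and "Im (- \<i> * polylog_diff a 2 \<i>) = 0"
proof -
  define L where "L = - \<i> * polylog_diff a 2 \<i>"
  define H where "H s = (Ln (1 + of_real s * (of_real a * \<i>)) - Ln (1 - of_real s * (of_real a * \<i>))) / (\<i> * of_real s)"
    for s :: real
  have pos: "1 + of_real s * (\<i> * of_real b) \<notin> \<real>\<^sub>\<le>\<^sub>0" for s b :: real
    by (rule Re_pos_not_nonpos_Reals) simp
  have H: "(H has_integral L) {0..1}"
  proof -
    have "((\<lambda>s. - \<i> * (- Ln (1 - of_real s * (\<i> * of_real a)) / of_real s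
               - - Ln (1 - of_real s * (- \<i> * of_real a)) / of_real s)) has_integral L) {0..1}"
      unfolding L_def polylog_diff_def
      by (intro has_integral_mult_right has_integral_diff polylog_2_has_integral)
         (auto simp: complex_nonpos_Reals_iff)
    then show ?thesis
      by (rule has_integral_eq[rotated]) (auto simp: H_def divide_inverse algebra_simps)
  qed
  show "Im (- \<i> * polylog_diff a 2 \<i>) = 0"
  proof -
    have "Im (H s) = 0" for s
    proof -
      have "Ln (1 - of_real s * (of_real a * \<i>)) = cnj (Ln (1 + of_real s * (of_real a * \<i>)))"
        using cnj_Ln[OF pos[of s a]] by (simp add: mult.commute)
      then have "H s = of_real (2 * Im (Ln (1 + of_real s * (of_real a * \<i>))) / s)"
        by (simp add: H_def complex_diff_cnj field_simps)
      then show ?thesis by simp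
    qed
    moreover have "((\<lambda>s. Im (H s)) has_integral Im L) {0..1}"
      by (rule has_integral_linear[OF H bounded_linear_Im, unfolded o_def])
    ultimately show ?thesis
      unfolding L_def[symmetric] by (simp add: has_integral_unique[of "\<lambda>s. 0"])
  qed
  define I where "I c \<alpha> \<beta> = integral {\<alpha>..\<beta>} (\<lambda>\<theta>. Ln (1 + c * cis \<theta>))" for c :: complex and \<alpha> \<beta> :: real
  have cos1: "0 \<le> cos u" if "u \<in> {0..pi/2}" for u
    using that by (intro cos_ge_zero) auto
  have cos2: "cos u \<le> 0" if "u \<in> {pi/2..3*pi/2}" for u
    using that cos_ge_zero[of "u - pi"] by (simp add: cos_diff)
  have cos3: "0 \<le> cos u" if "u \<in> {3*pi/2..2*pi}" for u
    using that cos_ge_zero[of "u - 2*pi"] by (simp add: cos_diff)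
  have cut: "1 + of_real s * (of_real b * cis u) \<notin> \<real>\<^sub>\<le>\<^sub>0" if "0 \<le> b * cos u" "0 \<le> s" for s b u :: real
  proof (rule Re_pos_not_nonpos_Reals)
    have "0 \<le> s * (b * cos u)" using that by simp
    then show "0 < Re (1 + of_real s * (of_real b * cis u))" by simp
  qed
  have cis_pts: "cis (pi/2) = \<i>" "cis (3*pi/2) = - \<i>"
    using cos_3over2_pi sin_3over2_pi by (simp_all add: complex_eq_iff)
  have "((\<lambda>s. (Ln (1 + of_real s * (of_real a * cis (pi/2))) - Ln (1 + of_real s * (of_real a * cis 0))) / (\<i> * of_real s)
            + (Ln (1 + of_real s * (of_real (-a) * cis (3*pi/2))) - Ln (1 + of_real s * (of_real (-a) * cis (pi/2)))) / (\<i> * of_real s)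
            + (Ln (1 + of_real s * (of_real a * cis (2*pi))) - Ln (1 + of_real s * (of_real a * cis (3*pi/2)))) / (\<i> * of_real s))
         has_integral I (of_real a) 0 (pi/2) + I (of_real (-a)) (pi/2) (3*pi/2) + I (of_real a) (3*pi/2) (2*pi)) {0..1}"
    unfolding I_def
    by (intro has_integral_add integral_Ln_arc cut)
       (use a cos1 cos2 cos3 in \<open>auto simp: mult_nonneg_nonpos zero_le_mult_iff mult_le_0_iff\<close>)
  then have "((\<lambda>s. 2 * H s) has_integral I (of_real a) 0 (pi/2) + I (of_real (-a)) (pi/2) (3*pi/2) + I (of_real a) (3*pi/2) (2*pi)) {0..1}"
    by (rule has_integral_eq[rotated]) (simp add: H_def cis_pts diff_divide_distrib)
  then have total: "I (of_real a) 0 (pi/2) + I (of_real (-a)) (pi/2) (3*pi/2) + I (of_real a) (3*pi/2) (2*pi) = 2 * L"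
    using has_integral_mult_right[OF H, of 2] by (rule has_integral_unique)
  define h where "h u = ln (max (cmod (1 + of_real a * cis u)) (cmod (1 - of_real a * cis u)))" for u
  have piece: "(h has_integral Re (I (of_real b) \<alpha> \<beta>)) {\<alpha>..\<beta>}"
    if "\<And>u. u \<in> {\<alpha>..\<beta>} \<Longrightarrow> 0 \<le> b * cos u" "b = a \<or> b = - a" for b \<alpha> \<beta>
  proof -
    have "((\<lambda>\<theta>. ln (cmod (1 + of_real b * cis \<theta>))) has_integral Re (I (of_real b) \<alpha> \<beta>)) {\<alpha>..\<beta>}"
      unfolding I_def by (rule has_integral_ln_cmod_arc) (use cut[of b _ 1] that in auto)
    moreover have "ln (cmod (1 + of_real b * cis u)) = h u" if u: "u \<in> {\<alpha>..\<beta>}" for u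
    proof -
      have "(cmod (1 - of_real b * cis u))\<^sup>2 \<le> (cmod (1 + of_real b * cis u))\<^sup>2"
        using \<open>\<And>u. u \<in> {\<alpha>..\<beta>} \<Longrightarrow> 0 \<le> b * cos u\<close>[OF u]
        by (simp add: cmod_one_plus_squared cmod_one_minus_squared)
      then have "cmod (1 - of_real b * cis u) \<le> cmod (1 + of_real b * cis u)"
        by (rule power2_le_imp_le) simp
      then show ?thesis using \<open>b = a \<or> b = - a\<close> by (auto simp: h_def max_def)
    qed
    ultimately show ?thesis by (rule has_integral_eq[rotated])
  qed
  have "(h has_integral Re (I (of_real a) 0 (pi/2)) + Re (I (of_real (-a)) (pi/2) (3*pi/2))) {0..3*pi/2}"
    by (rule has_integral_combine[of _ "pi/2"]; (intro piece)?)
       (use a cos1 cos2 in \<open>auto simp: mult_nonneg_nonpos zero_le_mult_iff mult_le_0_iff\<close>)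
  then have "(h has_integral Re (I (of_real a) 0 (pi/2)) + Re (I (of_real (-a)) (pi/2) (3*pi/2))
      + Re (I (of_real a) (3*pi/2) (2*pi))) {0..2*pi}"
    by (rule has_integral_combine[of _ "3*pi/2", rotated 2]; (intro piece)?)
       (use a cos3 in \<open>auto simp: zero_le_mult_iff\<close>)
  also have "Re (I (of_real a) 0 (pi/2)) + Re (I (of_real (-a)) (pi/2) (3*pi/2))
      + Re (I (of_real a) (3*pi/2) (2*pi)) = 2 * Re L"
    using arg_cong[OF total, of Re] by simp
  finally show "((\<lambda>u. ln (max (cmod (1 + of_real a * cis u)) (cmod (1 - of_real a * cis u)))) has_integral
            2 * Re (- \<i> * polylog_diff a 2 \<i>)) {0..2*pi}"
    by (simp add: h_def L_def)
qed

theorem theorem12: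
  fixes a :: real
  defines "x \<equiv> mpoly_var (1::2)" and "y \<equiv> mpoly_var (2::2)"
  assumes "a > 0"
  shows "complex_of_real (pi * mahler_measure ((1 + x) + mpoly_const (of_real a) * (1 - x) * y))
       = - \<i> * polylog_diff a 2 \<i>"
proof -
  define A where "A u = 1 + of_real a * cis u" for u
  define B where "B u = 1 - of_real a * cis u" for u
  define T where "T = (LINT \<theta>|(\<Pi>\<^sub>M k\<in>{2, 1::2}. lborel). indicator {0..2*pi} (\<theta> 2) * indicator {0..2*pi} (\<theta> 1) *
              ln (cmod (A (\<theta> 2) + B (\<theta> 2) * cis (\<theta> 1))))"
  have AB: "(cmod (A u))\<^sup>2 = 1 + a\<^sup>2 + 2 * a * cos u" "(cmod (B u))\<^sup>2 = 1 + a\<^sup>2 - 2 * a * cos u" for u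
    by (simp_all add: A_def B_def cmod_one_plus_squared cmod_one_minus_squared)
  have "((\<lambda>u. 2 * pi * ln (max (cmod (A u)) (cmod (B u)))) has_integral T) {0..2*pi}"
    unfolding T_def
  proof (rule integral_torus_ln_cmod)
    show "A \<in> borel_measurable borel" "B \<in> borel_measurable borel"
      unfolding A_def B_def by (intro borel_measurable_continuous_onI continuous_intros)+
    show "(2::2) \<noteq> 1" by simp
    show "finite {pi/2, 3*pi/2}" by simp
    fix u
    show "cmod (A u) + cmod (B u) \<le> 2 + 2 * a"
      using norm_triangle_ineq[of 1 "of_real a * cis u"] norm_triangle_ineq4[of 1 "of_real a * cis u"]
        \<open>a > 0\<close> by (simp add: A_def B_def norm_mult)
    have "1 \<le> cmod (A u) \<or> 1 \<le> cmod (B u)"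
    proof (cases "0 \<le> cos u")
      case True
      then have "1 \<le> (cmod (A u))\<^sup>2" using \<open>a > 0\<close> by (simp add: AB)
      then show ?thesis using power2_le_imp_le[of 1 "cmod (A u)"] by simp
    next
      case False
      then have "2 * a * cos u \<le> 0" using \<open>a > 0\<close> by (simp add: mult_le_0_iff)
      then have "1 \<le> (cmod (B u))\<^sup>2"
        unfolding AB using zero_le_power2[of a] by linarith
      then show ?thesis using power2_le_imp_le[of 1 "cmod (B u)"] by simp
    qed
    then show "1 \<le> max (cmod (A u)) (cmod (B u))" by auto
    assume u: "u \<in> {0..2*pi} - {pi/2, 3*pi/2}"
    (* The zeros of the cosine in [0, 2 pi] are the two excluded points. Shifting u by 0, pi or
       2 pi brings it into the interval (-pi/2, pi/2), where the cosine is positive. *)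
    have "cos u \<noteq> 0"
    proof -
      consider "-(pi/2) < u" "u < pi/2" | "-(pi/2) < u - pi" "u - pi < pi/2"
        | "-(pi/2) < u - 2*pi" "u - 2*pi < pi/2"
        using u by (auto simp: not_less) argo
      then show ?thesis
        by cases (auto dest!: cos_gt_zero_pi simp: cos_diff)
    qed
    then have "(cmod (A u))\<^sup>2 \<noteq> (cmod (B u))\<^sup>2" using \<open>a > 0\<close> by (simp add: AB)
    then show "cmod (A u) \<noteq> cmod (B u)" by auto
  qed
  moreover have "((\<lambda>u. 2 * pi * ln (max (cmod (A u)) (cmod (B u)))) has_integral
      2 * pi * (2 * Re (- \<i> * polylog_diff a 2 \<i>))) {0..2*pi}"
    unfolding A_def B_def by (intro has_integral_mult_right has_integral_ln_max_cmod \<open>a > 0\<close>)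
  ultimately have T: "T = 4 * pi * Re (- \<i> * polylog_diff a 2 \<i>)"
    by (auto dest: has_integral_unique)
  have ind: "indicator (UNIV \<rightarrow> {0..2*pi}) \<theta> *\<^sub>R w = indicator {0..2*pi} (\<theta> 2) * indicator {0..2*pi} (\<theta> 1) * w"
    for \<theta> :: "2 \<Rightarrow> real" and w :: real
    by (auto simp: indicator_def Pi_iff forall_2)
  have "mahler_measure ((1 + x) + mpoly_const (of_real a) * (1 - x) * y) = 1 / (2 * pi)\<^sup>2 * T"
    unfolding mahler_measure_def x_def y_def mpoly_eval_bilinear set_lebesgue_integral_def T_def A_def B_def ind
    by (simp add: UNIV_2 power2_eq_square)
  then have "pi * mahler_measure ((1 + x) + mpoly_const (of_real a) * (1 - x) * y)
      = Re (- \<i> * polylog_diff a 2 \<i>)"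
    using T by (simp add: power2_eq_square field_simps)
  then show ?thesis
    using has_integral_ln_max_cmod(2)[OF \<open>a > 0\<close>] by (simp add: complex_eq_iff)
qed

end
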